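(* Let $p(x,y)=\sum_{i+j\le 3}\alpha_{ij}x^iy^j$ be a bivariate polynomial of degree $3$ with complex coefficients and $\alpha_{30}\neq 0$, and suppose that the univariate polynomial \[ h(s)=\alpha_{30}s^3+\alpha_{21}s^2+\alpha_{12}s+\alpha_{03} \] does not have a triple root. Then there exist matrices $A,B,C\in\mathbb{C}^{3\times3}$ such that $\det(A+xB+yC)=p(x,y)$.
   Context: The sum ranges over nonnegative integers $i,j$ with $i+j\le3$, and the determinant identity is an identity of polynomials in $x$ and $y$. *)

theory Defs
  imports "HOL-Analysis.Analysis" "HOL-Computational_Algebra.Polynomial"
begin

text \<open>
  The ring \<open>\<complex>[x, y]\<close> is represented by \<^typ>\<open>complex poly poly\<close>, read as \<open>\<complex>[x][y]\<close>:
  the coefficients of the outer polynomial (in \<open>y\<close>) are polynomials in \<open>x\<close>.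
\<close>

type_synonym bipoly = "complex poly poly"

definition bconst :: "complex \<Rightarrow> bipoly" where
  "bconst c = [:[:c:]:]"

definition var_x :: bipoly where
  "var_x = [:[:0, 1:]:]"

definition var_y :: bipoly where
  "var_y = [:0, 1:]"

definition cubic :: "(nat \<Rightarrow> nat \<Rightarrow> complex) \<Rightarrow> bipoly" where
  "cubic \<alpha> = (\<Sum>(i, j) \<in> {(i, j). i + j \<le> 3}. bconst (\<alpha> i j) * var_x ^ i * var_y ^ j)"

definition top_form :: "(nat \<Rightarrow> nat \<Rightarrow> complex) \<Rightarrow> complex poly" where
  "top_form \<alpha> = [:\<alpha> 0 3, \<alpha> 1 2, \<alpha> 2 1, \<alpha> 3 0:]"

definition pencil ::
    "complex ^ 'n ^ 'n \<Rightarrow> complex ^ 'n ^ 'n \<Rightarrow> complex ^ 'n ^ 'n \<Rightarrow> bipoly ^ 'n ^ 'n" where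
  "pencil A B C =
     map_matrix bconst A + map_matrix (\<lambda>b. var_x * bconst b) B + map_matrix (\<lambda>c. var_y * bconst c) C"

end

theory Submission
  imports Defs "HOL-Computational_Algebra.Fundamental_Theorem_Algebra"
begin

text \<open>
  The matrix with rows \<open>(a, -1, 0)\<close>, \<open>(f, b, -1)\<close>, \<open>(c, d, e)\<close> has determinant
  \<open>a b e + a d + f e + c\<close>.
  Take \<open>a\<close>, \<open>b\<close>, \<open>e\<close> to be the linear factors of the cubic form of \<open>p\<close>. As these are not
  all proportional, we may order them so that \<open>a\<close> and \<open>e\<close> are independent; then every
  quadratic form is \<open>a d + f e\<close> for some linear forms \<open>d\<close>, \<open>f\<close>, and \<open>c\<close> absorbs the affine part.
\<close>

lemma top_form_factorization:
  assumes "\<alpha> 3 0 \<noteq> 0"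
  obtains r s t where
    "top_form \<alpha> = smult (\<alpha> 3 0) ([:-r, 1:] * [:-s, 1:] * [:-t, 1:])"
proof -
  have nz: "top_form \<alpha> \<noteq> 0" and deg: "degree (top_form \<alpha>) = 3"
    and lead: "lead_coeff (top_form \<alpha>) = \<alpha> 3 0"
    using assms by (auto simp: top_form_def)
  obtain R where "size R = 3"
    and fac: "top_form \<alpha> = smult (\<alpha> 3 0) (\<Prod>r\<in>#R. [:-r, 1:])"
    using alg_closed_imp_factorization[OF nz] deg lead by auto
  then obtain r R' where "R = add_mset r R'" "size R' = 2"
    by (metis eval_nat_numeral(3) size_eq_Suc_imp_eq_union size_add_mset nat.inject)
  moreover from this obtain s R'' where "R' = add_mset s R''" "size R'' = 1"
    by (metis Suc_1 size_eq_Suc_imp_eq_union size_add_mset nat.inject)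
  moreover from this obtain t where "R'' = {#t#}"
    using size_1_singleton_mset by blast
  ultimately have "R = {#r, s, t#}" by simp
  with fac show thesis
    by (intro that[of r s t]) (simp add: algebra_simps)
qed

lemma order_linear_cube:
  fixes a r :: complex
  assumes "a \<noteq> 0"
  shows "order r (smult a ([:-r, 1:] * [:-r, 1:] * [:-r, 1:])) = 3"
  using assms order_power_n_n[of r 3]
  by (simp add: order_smult power3_eq_cube del: mult_pCons_left mult_pCons_right)

text \<open>If \<open>r\<close> and \<open>t\<close> coincide, \<open>s\<close> differs from them,
  as \<open>r\<close> would otherwise be a triple root; swapping \<open>r\<close> and
  \<open>s\<close> then makes the outer roots distinct.\<close>

lemma top_form_factorization_distinct:
  assumes "\<alpha> 3 0 \<noteq> 0" and "\<not> (\<exists>r. order r (top_form \<alpha>) = 3)"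
  obtains r s t where "r \<noteq> t"
    and "top_form \<alpha> = smult (\<alpha> 3 0) ([:-r, 1:] * [:-s, 1:] * [:-t, 1:])"
proof -
  obtain r s t where fac: "top_form \<alpha> = smult (\<alpha> 3 0) ([:-r, 1:] * [:-s, 1:] * [:-t, 1:])"
    using assms(1) by (rule top_form_factorization)
  show thesis
  proof (cases "r = t")
    case False
    then show thesis using fac that by blast
  next
    case True
    then have "s \<noteq> r" using order_linear_cube[OF assms(1)] fac assms(2) by metis
    moreover have "top_form \<alpha> = smult (\<alpha> 3 0) ([:-s, 1:] * [:-r, 1:] * [:-t, 1:])"
      using fac by (simp only: mult.commute mult.left_commute)
    ultimately show thesis using that True by metis
  qed
qed

lemma cubic_coeffs:
  "cubic \<alpha> = [:[:\<alpha> 0 0, \<alpha> 1 0, \<alpha> 2 0, \<alpha> 3 0:], [:\<alpha> 0 1, \<alpha> 1 1, \<alpha> 2 1:], [:\<alpha> 0 2, \<alpha> 1 2:], [:\<alpha> 0 3:]:]"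
proof -
  have "{(i, j). i + j \<le> (3::nat)} =
      {(0,0),(1,0),(2,0),(3,0),(0,1),(1,1),(2,1),(0,2),(1,2),(0,3)}"
    by auto
  then show ?thesis
    by (simp add: cubic_def bconst_def var_x_def var_y_def power2_eq_square power3_eq_cube)
qed

lemma pencil_entry:
  "pencil A B C $ i $ j = [:[:A $ i $ j, B $ i $ j:], [:C $ i $ j:]:]"
  by (simp add: pencil_def map_matrix_def bconst_def var_x_def var_y_def)

theorem mainTheorem3:
  fixes \<alpha> :: "nat \<Rightarrow> nat \<Rightarrow> complex"
  assumes "\<alpha> 3 0 \<noteq> 0"
    and "\<not> (\<exists>r. order r (top_form \<alpha>) = 3)"
  shows "\<exists>A B C :: complex ^ 3 ^ 3. det (pencil A B C) = cubic \<alpha>"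
proof -
  define k where "k = \<alpha> 3 0"
  obtain r s t where "r \<noteq> t"
    and fac: "top_form \<alpha> = smult k ([:-r, 1:] * [:-s, 1:] * [:-t, 1:])"
    unfolding k_def using top_form_factorization_distinct[OF assms] .
  have top: "\<alpha> 2 1 = - k * (r + s + t)" "\<alpha> 1 2 = k * (r * s + r * t + s * t)" "\<alpha> 0 3 = - k * r * s * t"
    using fac by (auto simp: top_form_def algebra_simps)
  \<comment> \<open>\<open>\<alpha>\<^sub>2\<^sub>0 x\<^sup>2 + \<alpha>\<^sub>1\<^sub>1 x y + \<alpha>\<^sub>0\<^sub>2 y\<^sup>2 = (x - r y) (\<alpha>\<^sub>2\<^sub>0 x + u y) + (m - u) y (x - t y)\<close>\<close>
  define m where "m = \<alpha> 1 1 + r * \<alpha> 2 0"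
  \<comment> \<open>Comparing y^2 coefficients gives a linear equation for \<open>u\<close> with
    nonzero slope \<open>t - r\<close>.\<close>
  define u where "u = (\<alpha> 0 2 + t * m) / (t - r)"
  have "u * (t - r) = \<alpha> 0 2 + t * m"
    using \<open>r \<noteq> t\<close> by (simp add: u_def)
  then have quad: "\<alpha> 0 2 = - r * u - t * (m - u)" "\<alpha> 1 1 = m - r * \<alpha> 2 0"
    by (simp_all add: m_def algebra_simps)
  \<comment> \<open>Diagonal: x - r y, k (x - s y), x - t y, with the leading coefficient in the
    middle. Below it: f = (m - u) y, d = \<alpha>20 x + u y, and c the affine part of p.\<close>
  define A :: "complex ^ 3 ^ 3" where
    "A = vector [vector [0, -1, 0], vector [0, 0, -1], vector [\<alpha> 0 0, 0, 0]]"
  define B :: "complex ^ 3 ^ 3" where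
    "B = vector [vector [1, 0, 0], vector [0, k, 0], vector [\<alpha> 1 0, \<alpha> 2 0, 1]]"
  define C :: "complex ^ 3 ^ 3" where
    "C = vector [vector [-r, 0, 0], vector [m - u, - k * s, 0], vector [\<alpha> 0 1, u, -t]]"
  have "det (pencil A B C) = cubic \<alpha>"
    unfolding cubic_coeffs det_3 pencil_entry top quad k_def[symmetric]
    by (simp add: A_def B_def C_def algebra_simps)
  then show ?thesis by blast
qed

end
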